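(* Let $a\in(-1,1)$ (regarded as a point of the unit disk $\mathbb{U}$) and let $\ell\in T_a\mathbb{C}\cong\mathbb{C}$ be a unit vector. Let $f$ be the conformal mapping of $\mathbb{U}$ onto the strip $\mathbb{S}_0$ with $f(a)=0$ and $f'(a)>0$, and $u_0=\operatorname{Re}f$. Let $f_\ell$ be the conformal mapping of $\mathbb{U}$ onto $\mathbb{S}_0$ with $f_\ell(a)=0$ and $f_\ell'(a)\ell>0$, and $u_\ell=\operatorname{Re}f_\ell$. Then (1) $L(a)=\frac{\partial u_0}{\partial x}(a)=\frac4\pi(1-|a|^2)^{-1}$; (2) $L(a,\ell)=L(a)=(du_\ell)_a(\ell)=\frac4\pi(1-|a|^2)^{-1}$.
   Context: $\mathbb{U}$ is the open unit disk in $\mathbb{C}$ and $\mathbb{S}_0=\{w\in\mathbb{C}:-1<\operatorname{Re}w<1\}$. For $a\in\mathbb{U}$ and a unit vector $\ell$, $L(a)=\sup|(du)_a|$ and $L(a,\ell)=\sup|(du)_a(\ell)|$, where both suprema are over all real-valued harmonic functions $u:\mathbb{U}\to(-1,1)$, and $|(du)_a|=|\nabla u(a)|$. Here $\partial/\partial x$ is the derivative in the direction of the positive real axis. *)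

theory Defs
  imports "HOL-Complex_Analysis.Complex_Analysis"
begin

abbreviation unit_disk :: "complex set" where
  "unit_disk \<equiv> ball 0 1"

definition strip :: "complex set" where
  "strip = {w. -1 < Re w \<and> Re w < 1}"

definition conformal_map :: "(complex \<Rightarrow> complex) \<Rightarrow> complex set \<Rightarrow> complex set \<Rightarrow> bool" where
  "conformal_map f S T \<longleftrightarrow> f holomorphic_on S \<and> bij_betw f S T"

text \<open>The value at the vector \<open>v\<close> of the differential of \<open>u\<close> at \<open>z\<close>. Only meaningful where
  \<open>u\<close> is differentiable.\<close>

definition differential :: "(complex \<Rightarrow> real) \<Rightarrow> complex \<Rightarrow> complex \<Rightarrow> real" where
  "differential u z v = frechet_derivative u (at z) v"

definition partial_x :: "(complex \<Rightarrow> real) \<Rightarrow> complex \<Rightarrow> real" where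
  "partial_x u z = differential u z 1"

definition partial_y :: "(complex \<Rightarrow> real) \<Rightarrow> complex \<Rightarrow> real" where
  "partial_y u z = differential u z \<i>"

definition gradient :: "(complex \<Rightarrow> real) \<Rightarrow> complex \<Rightarrow> complex" where
  "gradient u z = Complex (partial_x u z) (partial_y u z)"

text \<open>Continuous (second) differentiability and harmonicity on an open set \<open>S\<close>; the values of
  the functions outside \<open>S\<close> play no role.\<close>

definition C1_on :: "(complex \<Rightarrow> real) \<Rightarrow> complex set \<Rightarrow> bool" where
  "C1_on u S \<longleftrightarrow> (\<forall>z\<in>S. u differentiable (at z)) \<and>
     continuous_on S (partial_x u) \<and> continuous_on S (partial_y u)"

definition C2_on :: "(complex \<Rightarrow> real) \<Rightarrow> complex set \<Rightarrow> bool" where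
  "C2_on u S \<longleftrightarrow> C1_on u S \<and> C1_on (partial_x u) S \<and> C1_on (partial_y u) S"

definition laplacian :: "(complex \<Rightarrow> real) \<Rightarrow> complex \<Rightarrow> real" where
  "laplacian u z = partial_x (partial_x u) z + partial_y (partial_y u) z"

definition harmonic_on :: "(complex \<Rightarrow> real) \<Rightarrow> complex set \<Rightarrow> bool" where
  "harmonic_on u S \<longleftrightarrow> open S \<and> C2_on u S \<and> (\<forall>z\<in>S. laplacian u z = 0)"

definition harmonic_competitors :: "(complex \<Rightarrow> real) set" where
  "harmonic_competitors = {u. harmonic_on u unit_disk \<and> u ` unit_disk \<subseteq> {-1<..<1}}"

text \<open>The suprema are taken in the extended reals, so that an equation with a real number
  includes the assertion that the supremum is finite. The first one is the supremum of
  \<open>\<bar>(du)\<^sub>a\<bar> = \<bar>\<nabla>u(a)\<bar>\<close>.\<close>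

definition L_grad :: "complex \<Rightarrow> ereal" where
  "L_grad a = (SUP u\<in>harmonic_competitors. ereal (norm (gradient u a)))"

definition L_dir :: "complex \<Rightarrow> complex \<Rightarrow> ereal" where
  "L_dir a l = (SUP u\<in>harmonic_competitors. ereal \<bar>differential u a l\<bar>)"

end

theory Submission
  imports Defs
begin

text \<open>
  The extremal problem is a Schwarz lemma in disguise. A harmonic function \<open>u\<close> on the disk with
  values in \<open>(-1, 1)\<close> is the real part of a holomorphic \<open>F\<close> with values in the strip
  (\<open>harmonic_on_convex_imp_Re_holomorphic\<close>), and \<open>\<bar>\<nabla>u(a)\<bar> = \<bar>F'(a)\<bar>\<close>. The strip is
  conformally the disk: \<open>w \<mapsto> exp (i \<pi> w / 2)\<close> maps it onto the right half-plane, and a Cayley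
  map finishes the job. The Schwarz--Pick inequality then bounds \<open>\<bar>F'(a)\<bar>\<close> by
  \<open>4 / (\<pi> (1 - \<bar>a\<bar>\<^sup>2))\<close> whatever the value of \<open>F\<close> at \<open>a\<close> (\<open>norm_deriv_strip_le\<close>), because
  the hyperbolic density of the strip is smallest on the imaginary axis.

  The bound is attained by every conformal map of the disk onto the strip that vanishes at \<open>a\<close>,
  as Schwarz--Pick also applies to its inverse (\<open>norm_deriv_conformal_map_strip\<close>). Only the
  argument of \<open>f'(a)\<close> is left free, and it decides the direction in which \<open>Re f\<close> grows fastest:
  when \<open>f'(a) l > 0\<close> the directional derivative along \<open>l\<close> is \<open>\<bar>f'(a)\<bar>\<close> itself. Hence each of the
  two suprema equals the common value, independently of \<open>l\<close>.
\<close>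

section \<open>Differentials of real functions on the plane\<close>

lemma has_derivative_differential:
  "u differentiable (at z) \<Longrightarrow> (u has_derivative differential u z) (at z)"
  unfolding differential_def by (simp add: frechet_derivative_works[symmetric])

lemma differential_eqI:
  assumes "(u has_derivative D) (at z)"
  shows "differential u z = D"
  using frechet_derivative_at[OF assms] by (auto simp: differential_def)

lemma differential_cong_open:
  assumes "open S" "z \<in> S" "\<And>w. w \<in> S \<Longrightarrow> u w = v w" "v differentiable (at z)"
  shows "differential u z = differential v z" "u differentiable (at z)"
proof -
  have "(u has_derivative differential v z) (at z)"
    by (rule has_derivative_transform_within_open[OF has_derivative_differential[OF assms(4)]
          assms(1,2)]) (simp add: assms(3))
  then show "differential u z = differential v z" "u differentiable (at z)"
    by (auto simp: differential_eqI differentiable_def)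
qed

lemma differential_coords:
  assumes "u differentiable (at z)"
  shows "differential u z v = Re v * partial_x u z + Im v * partial_y u z"
proof -
  interpret bounded_linear "differential u z"
    using has_derivative_differential[OF assms] by (rule has_derivative_bounded_linear)
  have "v = Re v *\<^sub>R 1 + Im v *\<^sub>R \<i>"
    by (simp add: complex_eq_iff)
  then have "differential u z v = differential u z (Re v *\<^sub>R 1 + Im v *\<^sub>R \<i>)"
    by simp
  also have "\<dots> = Re v * partial_x u z + Im v * partial_y u z"
    by (simp only: add scaleR partial_x_def partial_y_def real_scaleR_def)
  finally show ?thesis .
qed

lemma has_derivative_Re_holomorphic:
  assumes "f holomorphic_on S" "open S" "z \<in> S"
  shows "((\<lambda>w. Re (f w)) has_derivative (\<lambda>v. Re (deriv f z * v))) (at z)"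
proof -
  have "(f has_derivative (*) (deriv f z)) (at z)"
    using holomorphic_derivI[OF assms] by (simp add: has_field_derivative_def)
  then show ?thesis
    by (rule has_derivative_Re)
qed

lemma differential_Re_holomorphic:
  assumes "f holomorphic_on S" "open S" "z \<in> S"
  shows "differential (\<lambda>w. Re (f w)) z v = Re (deriv f z * v)"
  by (simp add: differential_eqI[OF has_derivative_Re_holomorphic[OF assms]])

lemma C1_on_cong:
  assumes "open S" "\<And>z. z \<in> S \<Longrightarrow> u z = v z" "C1_on v S"
  shows "C1_on u S"
proof -
  have d: "differential u z = differential v z" "u differentiable (at z)" if "z \<in> S" for z
    using differential_cong_open[OF assms(1) that, of u v] assms(2,3) that
    by (auto simp: C1_on_def)
  have "continuous_on S (partial_x u) = continuous_on S (partial_x v)"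
    by (rule continuous_on_cong) (auto simp: partial_x_def d)
  moreover have "continuous_on S (partial_y u) = continuous_on S (partial_y v)"
    by (rule continuous_on_cong) (auto simp: partial_y_def d)
  ultimately show ?thesis
    using assms(3) d(2) by (simp add: C1_on_def)
qed

lemma C1_on_Re_holomorphic:
  assumes "f holomorphic_on S" "open S"
  shows "C1_on (\<lambda>w. Re (f w)) S"
proof -
  have "continuous_on S (deriv f)"
    using assms holomorphic_deriv holomorphic_on_imp_continuous_on by blast
  then have "continuous_on S (\<lambda>z. Re (deriv f z * v))" for v
    by (intro continuous_intros)
  then have "continuous_on S (\<lambda>z. differential (\<lambda>w. Re (f w)) z v)" for v
    using differential_Re_holomorphic[OF assms] continuous_on_cong[of S S] by force
  then show ?thesis
    using has_derivative_Re_holomorphic[OF assms]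
    by (auto simp: C1_on_def partial_x_def[abs_def] partial_y_def[abs_def] differentiable_def)
qed

section \<open>Harmonic functions and holomorphic functions\<close>

lemma harmonic_on_Re_holomorphic:
  assumes f: "f holomorphic_on S" and S: "open S"
  shows "harmonic_on (\<lambda>w. Re (f w)) S"
proof -
  let ?u = "\<lambda>w. Re (f w)"
  have f': "deriv f holomorphic_on S" and if': "(\<lambda>z. \<i> * deriv f z) holomorphic_on S"
    using f S by (auto intro!: holomorphic_intros holomorphic_deriv)
  have px: "partial_x ?u z = Re (deriv f z)" if "z \<in> S" for z
    using differential_Re_holomorphic[OF f S that] by (simp add: partial_x_def)
  have py: "partial_y ?u z = Re (\<i> * deriv f z)" if "z \<in> S" for z
    using differential_Re_holomorphic[OF f S that] by (simp add: partial_y_def)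
  have C2: "C2_on ?u S"
    unfolding C2_on_def
    using C1_on_cong[OF S px C1_on_Re_holomorphic[OF f' S]]
      C1_on_cong[OF S py C1_on_Re_holomorphic[OF if' S]] C1_on_Re_holomorphic[OF f S]
    by blast
  have "laplacian ?u z = 0" if z: "z \<in> S" for z
  proof -
    have "partial_x (partial_x ?u) z = Re (deriv (deriv f) z)"
      using differential_cong_open(1)[where v = "\<lambda>z. Re (deriv f z)", OF S z px]
        has_derivative_Re_holomorphic[OF f' S z]
      by (simp add: partial_x_def[of "partial_x ?u"] differentiableI
          differential_Re_holomorphic[OF f' S z])
    moreover have "partial_y (partial_y ?u) z = Re (deriv (\<lambda>z. \<i> * deriv f z) z * \<i>)"
      using differential_cong_open(1)[where v = "\<lambda>z. Re (\<i> * deriv f z)", OF S z py]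
        differentiableI[OF has_derivative_Re_holomorphic[OF if' S z]]
        differential_Re_holomorphic[OF if' S z, of \<i>]
      by (simp only: partial_y_def[of "partial_y ?u"])
    moreover have "deriv (\<lambda>z. \<i> * deriv f z) z = \<i> * deriv (deriv f) z"
      using holomorphic_on_imp_differentiable_at[OF f' S z] by simp
    ultimately show ?thesis
      by (simp add: laplacian_def)
  qed
  with C2 S show ?thesis
    by (simp add: harmonic_on_def)
qed

text \<open>
  Two applications of the one-dimensional mean value theorem: first along \<open>v\<close> to the difference
  of \<open>u\<close> on two opposite sides of a parallelogram, then along \<open>w\<close> to the differential in the
  direction \<open>v\<close>. The left-hand side is symmetric in \<open>v\<close> and \<open>w\<close>, which is what forces mixed
  derivatives to agree.
\<close>

lemma second_difference_mean_value:
  fixes u :: "complex \<Rightarrow> real"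
  assumes u: "\<And>z. z \<in> ball p r \<Longrightarrow> u differentiable (at z)"
    and uv: "\<And>z. z \<in> ball p r \<Longrightarrow> (\<lambda>z. differential u z v) differentiable (at z)"
    and t: "t > 0" "t * (norm v + norm w) < r"
  shows "\<exists>z\<in>ball p r. u (p + t *\<^sub>R v + t *\<^sub>R w) - u (p + t *\<^sub>R v) - u (p + t *\<^sub>R w) + u p
           = t\<^sup>2 * differential (\<lambda>z. differential u z v) z w"
proof -
  have inb: "p + x *\<^sub>R v + y *\<^sub>R w \<in> ball p r" if "0 \<le> x" "x \<le> t" "0 \<le> y" "y \<le> t" for x y
  proof -
    have "norm (x *\<^sub>R v + y *\<^sub>R w) \<le> x * norm v + y * norm w"
      using norm_triangle_ineq[of "x *\<^sub>R v" "y *\<^sub>R w"] that by simp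
    also have "\<dots> \<le> t * (norm v + norm w)"
      using that by (simp add: distrib_left add_mono mult_right_mono)
    finally have "norm (x *\<^sub>R v + y *\<^sub>R w) < r"
      using t by linarith
    then show ?thesis
      using dist_add_cancel[of p 0 "x *\<^sub>R v + y *\<^sub>R w"] by (simp add: add.assoc)
  qed
  \<comment> \<open>The chain rule along a line, which reduces both steps to functions of a real variable.\<close>
  have line: "((\<lambda>s. g (c + s *\<^sub>R d)) has_real_derivative differential g (c + s *\<^sub>R d) d) (at s)"
    if "g differentiable (at (c + s *\<^sub>R d))" for g :: "complex \<Rightarrow> real" and c d s
  proof -
    have "((\<lambda>s. g (c + s *\<^sub>R d)) has_derivative
        (\<lambda>h. differential g (c + s *\<^sub>R d) (h *\<^sub>R d))) (at s)"
      by (rule has_derivative_compose[where f = "\<lambda>s. c + s *\<^sub>R d", OF _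
            has_derivative_differential[OF that]])
         (auto intro!: derivative_eq_intros)
    moreover have "(\<lambda>h. differential g (c + s *\<^sub>R d) (h *\<^sub>R d)) = (*) (differential g (c + s *\<^sub>R d) d)"
      using linear_scale[OF has_derivative_linear[OF has_derivative_differential[OF that]]]
      by (auto simp: mult.commute)
    ultimately show ?thesis
      by (simp add: has_field_derivative_def)
  qed
  define \<phi> where "\<phi> s = u (p + t *\<^sub>R w + s *\<^sub>R v) - u (p + s *\<^sub>R v)" for s
  have "\<exists>s>0. s < t \<and> \<phi> t - \<phi> 0 =
      (t - 0) * (differential u (p + t *\<^sub>R w + s *\<^sub>R v) v - differential u (p + s *\<^sub>R v) v)"
  proof (rule MVT2[OF t(1)])
    fix s assume s: "0 \<le> s" "s \<le> t"
    show "(\<phi> has_real_derivative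
        (differential u (p + t *\<^sub>R w + s *\<^sub>R v) v - differential u (p + s *\<^sub>R v) v)) (at s)"
      unfolding \<phi>_def[abs_def]
      using inb[of s t] inb[of s 0] s t(1)
      by (intro DERIV_diff line u) (simp_all add: algebra_simps)
  qed
  then obtain s where s: "0 < s" "s < t" and \<phi>: "\<phi> t - \<phi> 0 =
      t * (differential u (p + s *\<^sub>R v + t *\<^sub>R w) v - differential u (p + s *\<^sub>R v + 0 *\<^sub>R w) v)"
    by (auto simp: algebra_simps)
  have "\<exists>y>0. y < t \<and>
      differential u (p + s *\<^sub>R v + t *\<^sub>R w) v - differential u (p + s *\<^sub>R v + 0 *\<^sub>R w) v =
      (t - 0) * differential (\<lambda>z. differential u z v) (p + s *\<^sub>R v + y *\<^sub>R w) w"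
    by (rule MVT2[OF t(1)]) (use inb s in \<open>auto intro!: line uv\<close>)
  then obtain y where y: "0 < y" "y < t" and
    "\<phi> t - \<phi> 0 = t * (t * differential (\<lambda>z. differential u z v) (p + s *\<^sub>R v + y *\<^sub>R w) w)"
    using \<phi> by auto
  then have "\<phi> t - \<phi> 0 = t\<^sup>2 * differential (\<lambda>z. differential u z v) (p + s *\<^sub>R v + y *\<^sub>R w) w"
    by (simp add: power2_eq_square)
  moreover have "\<phi> t - \<phi> 0 =
      u (p + t *\<^sub>R v + t *\<^sub>R w) - u (p + t *\<^sub>R v) - u (p + t *\<^sub>R w) + u p"
    by (simp add: \<phi>_def algebra_simps)
  ultimately show ?thesis
    using inb[of s y] s y by auto
qed

text \<open>
  If the mixed derivatives differed at \<open>p\<close>, continuity would keep their values apart on a small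
  ball, whereas the second difference over a square inside that ball equals \<open>t\<^sup>2\<close> times a value of
  either of them.
\<close>

lemma mixed_partials_commute:
  assumes S: "open S" "p \<in> S" and u: "C2_on u S"
  shows "partial_y (partial_x u) p = partial_x (partial_y u) p"
proof (rule ccontr)
  let ?xy = "partial_y (partial_x u)" and ?yx = "partial_x (partial_y u)"
  assume "?xy p \<noteq> ?yx p"
  define e where "e = dist (?xy p) (?yx p) / 2"
  have e: "e > 0"
    using \<open>?xy p \<noteq> ?yx p\<close> by (simp add: e_def)
  have "continuous_on S ?xy" "continuous_on S ?yx"
    using u by (auto simp: C2_on_def C1_on_def)
  then have "isCont ?xy p" "isCont ?yx p"
    using S continuous_on_eq_continuous_at by blast+
  then obtain d1 d2 where d: "d1 > 0" "d2 > 0"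
      "\<And>z. dist z p < d1 \<Longrightarrow> dist (?xy z) (?xy p) < e"
      "\<And>z. dist z p < d2 \<Longrightarrow> dist (?yx z) (?yx p) < e"
    using e unfolding continuous_at_eps_delta by metis
  obtain d0 where d0: "d0 > 0" "ball p d0 \<subseteq> S"
    using S openE by blast
  define r where "r = min d0 (min d1 d2)"
  \<comment> \<open>Any \<open>t\<close> with \<open>2 t < r\<close> would do: the square of side \<open>t\<close> at \<open>p\<close> has to fit into the ball.\<close>
  define t where "t = r / 3"
  have "r > 0"
    using d d0 by (simp add: r_def)
  then have t: "t > 0" "t * (1 + 1) < r"
    by (auto simp: t_def)
  have sub: "ball p r \<subseteq> S"
    using d0 by (auto simp: r_def)
  have diff: "u differentiable (at z)" "partial_x u differentiable (at z)"
      "partial_y u differentiable (at z)" if "z \<in> ball p r" for z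
    using u that sub by (auto simp: C2_on_def C1_on_def)
  let ?\<Delta> = "u (p + t *\<^sub>R 1 + t *\<^sub>R \<i>) - u (p + t *\<^sub>R 1) - u (p + t *\<^sub>R \<i>) + u p"
  have "\<exists>z\<in>ball p r. ?\<Delta> = t\<^sup>2 * ?xy z"
    unfolding partial_y_def partial_x_def[abs_def]
    by (rule second_difference_mean_value)
       (use diff t in \<open>simp_all add: partial_x_def[abs_def]\<close>)
  moreover have "\<exists>z\<in>ball p r. u (p + t *\<^sub>R \<i> + t *\<^sub>R 1) - u (p + t *\<^sub>R \<i>) - u (p + t *\<^sub>R 1) + u p
      = t\<^sup>2 * ?yx z"
    unfolding partial_x_def partial_y_def[abs_def]
    by (rule second_difference_mean_value)
       (use diff t in \<open>simp_all add: partial_y_def[abs_def]\<close>)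
  ultimately obtain z1 z2 where z: "z1 \<in> ball p r" "z2 \<in> ball p r" "t\<^sup>2 * ?xy z1 = t\<^sup>2 * ?yx z2"
    by (metis (no_types, lifting) add.commute add.left_commute diff_diff_eq)
  then have "?xy z1 = ?yx z2"
    using t(1) by simp
  moreover have "dist (?xy z1) (?xy p) < e" "dist (?yx z2) (?yx p) < e"
    using z(1,2) d(3)[of z1] d(4)[of z2] by (simp_all add: r_def dist_commute)
  ultimately show False
    using dist_triangle3[of "?xy p" "?yx p" "?xy z1"] by (simp add: e_def)
qed

text \<open>
  If \<open>u\<close> is to be \<open>Re F\<close>, then \<open>F'\<close> must be \<open>g = u\<^sub>x - i u\<^sub>y\<close>. The Cauchy--Riemann equations
  for \<open>g\<close> are the vanishing of the Laplacian and the symmetry of the mixed derivatives, so \<open>g\<close> is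
  holomorphic and, on a convex set, has a primitive; its real part differs from \<open>u\<close> by a constant.
\<close>

lemma harmonic_on_convex_imp_Re_holomorphic:
  assumes u: "harmonic_on u S" and S: "convex S"
  obtains F where "F holomorphic_on S" "\<And>z. z \<in> S \<Longrightarrow> u z = Re (F z)"
proof (cases "S = {}")
  case True
  then show ?thesis using that[of id] by auto
next
  case False
  have op: "open S" and C2: "C2_on u S" and lap: "\<And>z. z \<in> S \<Longrightarrow> laplacian u z = 0"
    using u by (auto simp: harmonic_on_def)
  have diff: "u differentiable (at z)" "partial_x u differentiable (at z)"
      "partial_y u differentiable (at z)" if "z \<in> S" for z
    using C2 that by (auto simp: C2_on_def C1_on_def)
  define g where "g z = of_real (partial_x u z) - \<i> * of_real (partial_y u z)" for z
  have "\<exists>D. (g has_field_derivative D) (at z)" if z: "z \<in> S" for z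
  proof -
    let ?a = "partial_x (partial_x u) z" and ?b = "partial_y (partial_x u) z"
    have sym: "partial_x (partial_y u) z = ?b" "partial_y (partial_y u) z = - ?a"
      using mixed_partials_commute[OF op z C2] lap[OF z] by (auto simp: laplacian_def)
    have "(g has_derivative (\<lambda>v. of_real (differential (partial_x u) z v)
        - \<i> * of_real (differential (partial_y u) z v))) (at z)"
      unfolding g_def[abs_def]
      by (intro has_derivative_diff has_derivative_mult_right has_derivative_of_real
          has_derivative_differential diff z)
    moreover have "of_real (differential (partial_x u) z v)
        - \<i> * of_real (differential (partial_y u) z v) = Complex ?a (- ?b) * v" for v
      by (simp add: differential_coords diff z sym complex_eq_iff algebra_simps)
    ultimately show ?thesis
      by (auto simp: has_field_derivative_def)
  qed
  then have "g holomorphic_on S"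
    using op by (metis holomorphic_on_open)
  then obtain F where F: "\<And>z. z \<in> S \<Longrightarrow> (F has_field_derivative g z) (at z within S)"
    using holomorphic_convex_primitive'[OF S op] by metis
  have F': "(F has_field_derivative g z) (at z)" if "z \<in> S" for z
    using F[OF that] at_within_open[OF that op] by simp
  have holF: "F holomorphic_on S"
    using F' op by (metis holomorphic_on_open)
  have "\<exists>c. \<forall>z\<in>S. u z - Re (F z) = c"
  proof (rule has_derivative_zero_constant[OF S])
    fix z assume z: "z \<in> S"
    have "((\<lambda>z. u z - Re (F z)) has_derivative (\<lambda>v. differential u z v - Re (g z * v))) (at z)"
      using F'[OF z] by (intro has_derivative_diff has_derivative_differential has_derivative_Re
          diff z) (simp add: has_field_derivative_def)
    moreover have "differential u z v - Re (g z * v) = 0" for v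
      by (simp add: differential_coords diff z g_def algebra_simps)
    ultimately show "((\<lambda>z. u z - Re (F z)) has_derivative (\<lambda>v. 0)) (at z within S)"
      by (simp add: has_derivative_at_withinI)
  qed
  then obtain c where c: "\<And>z. z \<in> S \<Longrightarrow> u z = Re (F z + of_real c)"
    by (force simp: algebra_simps)
  show ?thesis
    by (rule that[OF _ c]) (auto intro!: holomorphic_intros holF)
qed

section \<open>The Schwarz--Pick inequality at a point\<close>

lemma Moebius_function_has_field_derivative:
  assumes "1 - cnj w * z \<noteq> 0"
  shows "(Moebius_function 0 w has_field_derivative (1 - cnj w * w) / (1 - cnj w * z)\<^sup>2) (at z)"
  unfolding Moebius_function_simple[abs_def]
  by (rule derivative_eq_intros refl assms)+
     (simp add: assms power2_eq_square algebra_simps)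

text \<open>
  The Schwarz lemma for \<open>h = N \<circ> g \<circ> M\<close>, where the disk automorphism \<open>M\<close> takes \<open>0\<close> to \<open>a\<close> and \<open>N\<close>
  takes \<open>g a\<close> back to \<open>0\<close>. The factors \<open>1 - \<bar>a\<bar>\<^sup>2\<close> and \<open>1 / (1 - \<bar>g a\<bar>\<^sup>2)\<close> are their derivatives at
  these points.
\<close>

lemma Schwarz_Pick_deriv:
  assumes g: "g holomorphic_on ball 0 1" "g ` ball 0 1 \<subseteq> ball 0 1" and a: "norm a < 1"
  shows "norm (deriv g a) * (1 - (norm a)\<^sup>2) \<le> 1 - (norm (g a))\<^sup>2"
proof -
  define b where "b = g a"
  have b: "norm b < 1"
    using g a by (force simp: b_def)
  define M where "M = Moebius_function 0 (- a)"
  define N where "N = Moebius_function 0 b"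
  define h where "h = N \<circ> (g \<circ> M)"
  have sq: "1 - cnj w * w = of_real (1 - (norm w)\<^sup>2)" for w
    using complex_norm_square[of w] by (simp add: mult.commute)
  have pos: "(norm w)\<^sup>2 < 1" if "norm w < 1" for w :: complex
    using that by (simp add: power_less_one_iff)
  have M: "M holomorphic_on ball 0 1" "M ` ball 0 1 \<subseteq> ball 0 1" "M 0 = a"
    using a by (auto simp: M_def Moebius_function_holomorphic Moebius_function_norm_lt_1
        Moebius_function_of_zero)
  have N: "N holomorphic_on ball 0 1" "N ` ball 0 1 \<subseteq> ball 0 1" "N b = 0"
    using b by (auto simp: N_def Moebius_function_holomorphic Moebius_function_norm_lt_1
        Moebius_function_eq_zero)
  have M': "(M has_field_derivative of_real (1 - (norm a)\<^sup>2)) (at 0)"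
    using Moebius_function_has_field_derivative[of "- a" 0] by (simp add: M_def sq)
  have sq0: "complex_of_real (1 - (norm b)\<^sup>2) \<noteq> 0"
    using pos[OF b] by (simp only: of_real_eq_0_iff)
  have "(N has_field_derivative of_real (1 - (norm b)\<^sup>2) / (of_real (1 - (norm b)\<^sup>2))\<^sup>2) (at b)"
    using Moebius_function_has_field_derivative[of b b] sq0 unfolding N_def sq .
  moreover have "x / x\<^sup>2 = 1 / x" for x :: complex
    by (simp add: power2_eq_square)
  ultimately have N': "(N has_field_derivative 1 / of_real (1 - (norm b)\<^sup>2)) (at (g (M 0)))"
    by (simp only: M b_def)
  have g': "(g has_field_derivative deriv g a) (at (M 0))"
    using holomorphic_derivI[OF g(1) open_ball] a by (simp add: M)
  have h': "(h has_field_derivative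
      1 / of_real (1 - (norm b)\<^sup>2) * (deriv g a * of_real (1 - (norm a)\<^sup>2))) (at 0)"
    unfolding h_def by (intro DERIV_chain) (use N' g' M' in \<open>simp_all add: o_def\<close>)
  have "norm (deriv h 0) \<le> 1"
  proof (rule Schwarz_Lemma(2)[of _ 0])
    show "h holomorphic_on ball 0 1"
      unfolding h_def
      by (rule holomorphic_on_compose_gen[OF _ N(1)])
         (use M(2) g(2) in \<open>auto intro!: holomorphic_on_compose_gen[OF M(1) g(1)]\<close>)
    show "h 0 = 0"
      using M N by (simp add: h_def b_def)
    show "norm (h z) < 1" if "norm z < 1" for z
      using M N g that by (force simp: h_def)
  qed auto
  moreover have "norm (deriv h 0) = norm (deriv g a) * (1 - (norm a)\<^sup>2) / (1 - (norm b)\<^sup>2)"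
    unfolding DERIV_imp_deriv[OF h'] norm_mult norm_divide norm_of_real
    using pos[OF a] pos[OF b] by simp
  ultimately show ?thesis
    using pos[OF b] by (simp add: b_def divide_le_eq)
qed

section \<open>Holomorphic maps from the disk to the strip\<close>

text \<open>
  The map \<open>h = exp (i \<pi> F / 2)\<close> sends the disk to the right half-plane, and \<open>g\<close> follows it by the
  Cayley map that takes \<open>p = h a\<close> to \<open>0\<close>. Schwarz--Pick gives \<open>\<bar>g'(a)\<bar> (1 - \<bar>a\<bar>\<^sup>2) \<le> 1\<close>, while
  \<open>\<bar>g'(a)\<bar> = \<pi>/4 \<sqdot> \<bar>F'(a)\<bar> \<sqdot> \<bar>p\<bar> / Re p\<close>. The quotient \<open>\<bar>p\<bar> / Re p\<close> equals
  \<open>1 / cos (\<pi> Re (F a) / 2)\<close>; it is at least \<open>1\<close>, with equality when \<open>F a\<close> is purely imaginary.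
\<close>

lemma norm_deriv_strip_le:
  assumes F: "F holomorphic_on ball 0 1" "F ` ball 0 1 \<subseteq> strip" and a: "norm a < 1"
  shows "norm (deriv F a) \<le> 4 / pi * inverse (1 - (norm a)\<^sup>2)"
proof -
  define h where "h z = exp (\<i> * of_real (pi / 2) * F z)" for z
  have Re_h: "Re (h z) > 0" if "norm z < 1" for z
  proof -
    have "F z \<in> strip"
      using F that by force
    then have "- (pi / 2) < pi / 2 * Re (F z)" "pi / 2 * Re (F z) < pi / 2"
      using mult_strict_left_mono[of "-1" "Re (F z)" "pi / 2"] by (simp_all add: strip_def)
    then have "cos (pi / 2 * Re (F z)) > 0"
      by (intro cos_gt_zero_pi)
    then show ?thesis
      by (simp add: h_def Re_exp)
  qed
  define p where "p = h a"
  have p: "Re p > 0"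
    using Re_h[OF a] by (simp add: p_def)
  define g where "g z = (h z - p) / (h z + cnj p)" for z
  have den: "h z + cnj p \<noteq> 0" if "norm z < 1" for z
    using Re_h[OF that] p by (auto simp: complex_eq_iff)
  have hol_h: "h holomorphic_on ball 0 1"
    unfolding h_def[abs_def] by (intro holomorphic_intros F)
  have hol_g: "g holomorphic_on ball 0 1"
    unfolding g_def[abs_def] by (intro holomorphic_intros hol_h) (use den in auto)
  have "norm (g z) < 1" if "norm z < 1" for z
  proof -
    \<comment> \<open>A point of the right half-plane is closer to \<open>p\<close> than to its mirror image \<open>- cnj p\<close>.\<close>
    have "(norm (h z - p))\<^sup>2 + 4 * (Re (h z) * Re p) = (norm (h z + cnj p))\<^sup>2"
      unfolding cmod_power2 by (simp add: power2_eq_square algebra_simps)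
    moreover have "Re (h z) * Re p > 0"
      using Re_h[OF that] p by simp
    ultimately have "norm (h z - p) < norm (h z + cnj p)"
      by (intro power2_less_imp_less[OF _ norm_ge_zero]) linarith
    then show ?thesis
      using den[OF that] by (simp add: g_def norm_divide)
  qed
  then have "g ` ball 0 1 \<subseteq> ball 0 1"
    by auto
  then have SP: "norm (deriv g a) * (1 - (norm a)\<^sup>2) \<le> 1"
    using Schwarz_Pick_deriv[OF hol_g _ a] by (simp add: g_def p_def)
  have "(F has_field_derivative deriv F a) (at a)"
    using holomorphic_derivI[OF F(1) open_ball] a by simp
  then have h': "(h has_field_derivative \<i> * of_real (pi / 2) * deriv F a * p) (at a)"
    unfolding h_def[abs_def] p_def by (auto intro!: derivative_eq_intros)
  have "p + cnj p \<noteq> 0"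
    using den[OF a] by (simp add: p_def)
  have "(g has_field_derivative (\<i> * of_real (pi / 2) * deriv F a * p) / (p + cnj p)) (at a)"
    unfolding g_def[abs_def]
    by (rule derivative_eq_intros h' den[OF a] refl)+
       (use \<open>p + cnj p \<noteq> 0\<close> in \<open>simp add: flip: p_def\<close>)
  then have "deriv g a = (\<i> * of_real (pi / 2) * deriv F a * p) / of_real (2 * Re p)"
    by (simp add: DERIV_imp_deriv complex_add_cnj)
  then have norm_g': "norm (deriv g a) = pi / 2 * norm (deriv F a) * norm p / (2 * Re p)"
    using p by (simp add: norm_mult norm_divide)
  have "pi / 4 * norm (deriv F a) = pi / 2 * norm (deriv F a) * Re p / (2 * Re p)"
    using p by simp
  also have "\<dots> \<le> norm (deriv g a)"
    unfolding norm_g' using p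
    by (intro divide_right_mono mult_left_mono complex_Re_le_cmod) auto
  finally have "pi / 4 * norm (deriv F a) \<le> norm (deriv g a)" .
  moreover have "1 - (norm a)\<^sup>2 > 0"
    using a by (simp add: power_less_one_iff)
  ultimately have "pi / 4 * norm (deriv F a) * (1 - (norm a)\<^sup>2) \<le> 1"
    using SP mult_right_mono[of "pi / 4 * norm (deriv F a)" "norm (deriv g a)" "1 - (norm a)\<^sup>2"]
    by linarith
  then show ?thesis
    using \<open>1 - (norm a)\<^sup>2 > 0\<close> by (simp add: field_simps)
qed

text \<open>
  The lower bound comes from the inverse \<open>g\<close> of \<open>f\<close>. An explicit holomorphic map \<open>\<psi>\<close> of the disk
  into the strip with \<open>\<psi> 0 = 0\<close> and \<open>\<bar>\<psi>'(0)\<bar> = 4/\<pi>\<close> makes \<open>g \<circ> \<psi>\<close> a self-map of the disk with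
  \<open>0 \<mapsto> a\<close>, and Schwarz--Pick at \<open>0\<close> yields \<open>4/\<pi> \<sqdot> \<bar>g'(0)\<bar> \<le> 1 - \<bar>a\<bar>\<^sup>2\<close>, where
  \<open>g'(0) = 1 / f'(a)\<close>.
\<close>

lemma norm_deriv_conformal_map_strip:
  assumes f: "conformal_map f unit_disk strip" "f a = 0" and a: "norm a < 1"
  shows "norm (deriv f a) = 4 / pi * inverse (1 - (norm a)\<^sup>2)"
proof (rule antisym)
  have hol: "f holomorphic_on ball 0 1" and inj: "inj_on f (ball 0 1)" and im: "f ` ball 0 1 = strip"
    using f by (auto simp: conformal_map_def bij_betw_def)
  show "norm (deriv f a) \<le> 4 / pi * inverse (1 - (norm a)\<^sup>2)"
    using norm_deriv_strip_le[OF hol _ a] im by simp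
  obtain g where g: "g holomorphic_on strip" "\<And>z. z \<in> ball 0 1 \<Longrightarrow> deriv f z * deriv g (f z) = 1"
      "\<And>z. z \<in> ball 0 1 \<Longrightarrow> g (f z) = z"
    using holomorphic_has_inverse[OF hol open_ball inj] im by metis
  \<comment> \<open>The Cayley map onto the right half-plane, then the inverse of \<open>w \<mapsto> exp (i \<pi> w / 2)\<close>.\<close>
  define \<psi> where "\<psi> z = of_real (2 / pi) * (- \<i>) * Ln ((1 + z) / (1 - z))" for z
  have ne: "1 - z \<noteq> 0" if "norm z < 1" for z :: complex
    using that by auto
  have pos: "Re ((1 + z) / (1 - z)) > 0" if "norm z < 1" for z
  proof -
    have "(Re z)\<^sup>2 + (Im z)\<^sup>2 < 1"
      unfolding cmod_power2[symmetric] using that by (simp add: power_less_one_iff)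
    moreover have "(1 - Re z)\<^sup>2 + (Im z)\<^sup>2 > 0"
      using ne[OF that] complex_neq_0[of "1 - z"] by simp
    moreover have "Re ((1 + z) / (1 - z)) = (1 - ((Re z)\<^sup>2 + (Im z)\<^sup>2)) / ((1 - Re z)\<^sup>2 + (Im z)\<^sup>2)"
      unfolding Re_divide by (rule arg_cong2[where f = "(/)"]) (simp_all, algebra)
    ultimately show ?thesis
      by (simp only: divide_pos_pos diff_gt_0_iff_gt)
  qed
  have slit: "(1 + z) / (1 - z) \<notin> \<real>\<^sub>\<le>\<^sub>0" if "norm z < 1" for z :: complex
    using pos[OF that] unfolding complex_nonpos_Reals_iff by linarith
  have hol_\<psi>: "\<psi> holomorphic_on ball 0 1"
    unfolding \<psi>_def[abs_def]
    by (intro holomorphic_intros) (use slit ne in \<open>simp_all del: right_minus_eq\<close>)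
  have im_\<psi>: "\<psi> ` ball 0 1 \<subseteq> strip"
  proof -
    have "\<psi> z \<in> strip" if "norm z < 1" for z
    proof -
      have "\<bar>Im (Ln ((1 + z) / (1 - z)))\<bar> < pi / 2"
        using pos[OF that] Re_Ln_pos_lt by (metis less_numeral_extra(3) zero_complex.simps(1))
      then have "- (pi / 2) < Im (Ln ((1 + z) / (1 - z)))" "Im (Ln ((1 + z) / (1 - z))) < pi / 2"
        unfolding abs_less_iff by linarith+
      then show ?thesis
        by (simp add: \<psi>_def strip_def field_simps)
    qed
    then show ?thesis by auto
  qed
  have "open strip"
    using open_mapping_thm3[OF hol open_ball inj] im by simp
  have \<psi>0: "\<psi> 0 = 0"
    by (simp add: \<psi>_def)
  have "a \<in> ball 0 1"
    using a by simp
  then have g0: "g 0 = a" and fg: "deriv f a * deriv g 0 = 1"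
    using g(2,3)[of a] f by auto
  have "0 \<in> strip"
    by (simp add: strip_def)
  have \<psi>': "(\<psi> has_field_derivative of_real (2 / pi) * (- \<i>) * 2) (at 0)"
    unfolding \<psi>_def[abs_def] by (auto intro!: derivative_eq_intros)
  have "(g has_field_derivative deriv g 0) (at (\<psi> 0))"
    using holomorphic_derivI[OF g(1) \<open>open strip\<close> \<open>0 \<in> strip\<close>] by (simp add: \<psi>0)
  then have "(g \<circ> \<psi> has_field_derivative deriv g 0 * (of_real (2 / pi) * (- \<i>) * 2)) (at 0)"
    by (intro DERIV_chain \<psi>')
  then have "norm (deriv (g \<circ> \<psi>) 0) = norm (deriv g 0) * (4 / pi)"
    by (simp add: DERIV_imp_deriv norm_mult norm_divide)
  moreover have "norm (deriv (g \<circ> \<psi>) 0) * (1 - (norm (0::complex))\<^sup>2) \<le> 1 - (norm ((g \<circ> \<psi>) 0))\<^sup>2"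
  proof (rule Schwarz_Pick_deriv)
    show "g \<circ> \<psi> holomorphic_on ball 0 1"
      using hol_\<psi> g(1) im_\<psi> by (rule holomorphic_on_compose_gen)
    have "g ` strip \<subseteq> ball 0 1"
      unfolding im[symmetric] using g(3) by auto
    then show "(g \<circ> \<psi>) ` ball 0 1 \<subseteq> ball 0 1"
      using im_\<psi> by (auto simp: image_subset_iff)
  qed auto
  ultimately have "norm (deriv g 0) * (4 / pi) \<le> 1 - (norm a)\<^sup>2"
    by (simp add: \<psi>0 g0)
  moreover have "norm (deriv f a) * norm (deriv g 0) = 1"
    using fg by (metis norm_mult norm_one)
  moreover have "norm (deriv f a) > 0"
    using fg by auto
  ultimately have "4 / pi \<le> norm (deriv f a) * (1 - (norm a)\<^sup>2)"
    using mult_left_mono[of "norm (deriv g 0) * (4 / pi)" "1 - (norm a)\<^sup>2" "norm (deriv f a)"]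
    by (simp flip: mult.assoc)
  moreover have "1 - (norm a)\<^sup>2 > 0"
    using a by (simp add: power_less_one_iff)
  ultimately show "4 / pi * inverse (1 - (norm a)\<^sup>2) \<le> norm (deriv f a)"
    by (simp add: field_simps)
qed

section \<open>Gradients of bounded harmonic functions on the disk\<close>

lemma norm_gradient_Re_holomorphic:
  assumes "f holomorphic_on S" "open S" "z \<in> S"
  shows "norm (gradient (\<lambda>w. Re (f w)) z) = norm (deriv f z)"
proof -
  have "gradient (\<lambda>w. Re (f w)) z = cnj (deriv f z)"
    by (simp add: gradient_def partial_x_def partial_y_def differential_Re_holomorphic[OF assms]
        complex_eq_iff)
  then show ?thesis by simp
qed

lemma abs_differential_le_norm_gradient:
  assumes "u differentiable (at z)" "norm l = 1"
  shows "\<bar>differential u z l\<bar> \<le> norm (gradient u z)"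
proof -
  have "differential u z l = Re (cnj (gradient u z) * l)"
    by (simp add: differential_coords[OF assms(1)] gradient_def algebra_simps)
  then have "\<bar>differential u z l\<bar> \<le> norm (cnj (gradient u z) * l)"
    by (simp only: abs_Re_le_cmod)
  then show ?thesis
    using assms(2) by (simp add: norm_mult)
qed

lemma competitor_norm_gradient_le:
  assumes u: "u \<in> harmonic_competitors" and a: "norm a < 1"
  shows "norm (gradient u a) \<le> 4 / pi * inverse (1 - (norm a)\<^sup>2)"
proof -
  have "harmonic_on u unit_disk"
    using u by (simp add: harmonic_competitors_def)
  then obtain F where F: "F holomorphic_on unit_disk" "\<And>z. z \<in> unit_disk \<Longrightarrow> u z = Re (F z)"
    using harmonic_on_convex_imp_Re_holomorphic[OF _ convex_ball] by metis
  have "F ` unit_disk \<subseteq> strip"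
    using u F(2) by (force simp: harmonic_competitors_def strip_def)
  then have "norm (deriv F a) \<le> 4 / pi * inverse (1 - (norm a)\<^sup>2)"
    using norm_deriv_strip_le F a by blast
  moreover have a': "a \<in> unit_disk"
    using a by simp
  have "differential u a = differential (\<lambda>z. Re (F z)) a"
    using has_derivative_Re_holomorphic[OF F(1) open_ball a']
    by (intro differential_cong_open(1)[OF open_ball a'] F(2)) (auto simp: differentiable_def)
  then have "norm (gradient u a) = norm (deriv F a)"
    using norm_gradient_Re_holomorphic[OF F(1) open_ball a']
    by (simp add: gradient_def partial_x_def partial_y_def)
  ultimately show ?thesis by simp
qed

lemma Re_conformal_map_competitor:
  assumes "conformal_map f unit_disk strip"
  shows "(\<lambda>z. Re (f z)) \<in> harmonic_competitors"
  using assms harmonic_on_Re_holomorphic[of f unit_disk]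
  by (auto simp: harmonic_competitors_def conformal_map_def bij_betw_def strip_def)

theorem theorem4:
  fixes a :: real and l :: complex
    and f f\<^sub>l :: "complex \<Rightarrow> complex" and u\<^sub>0 u\<^sub>l :: "complex \<Rightarrow> real"
  assumes a: "-1 < a" "a < 1"
    and l: "norm l = 1"
    and f: "conformal_map f unit_disk strip" "f (of_real a) = 0"
    and f_deriv: "deriv f (of_real a) \<in> \<real>" "Re (deriv f (of_real a)) > 0"
    and u0: "u\<^sub>0 = (\<lambda>z. Re (f z))"
    and fl: "conformal_map f\<^sub>l unit_disk strip" "f\<^sub>l (of_real a) = 0"
    and fl_deriv: "deriv f\<^sub>l (of_real a) * l \<in> \<real>" "Re (deriv f\<^sub>l (of_real a) * l) > 0"
    and ul: "u\<^sub>l = (\<lambda>z. Re (f\<^sub>l z))"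
  shows "(L_grad (of_real a) = ereal (partial_x u\<^sub>0 (of_real a)) \<and>
          partial_x u\<^sub>0 (of_real a) = 4 / pi * inverse (1 - \<bar>a\<bar>\<^sup>2)) \<and>
         (L_dir (of_real a) l = L_grad (of_real a) \<and>
          L_grad (of_real a) = ereal (differential u\<^sub>l (of_real a) l) \<and>
          differential u\<^sub>l (of_real a) l = 4 / pi * inverse (1 - \<bar>a\<bar>\<^sup>2))"
proof -
  define b where "b = complex_of_real a"
  define K where "K = 4 / pi * inverse (1 - \<bar>a\<bar>\<^sup>2)"
  have b: "norm b < 1" "b \<in> unit_disk" and K: "4 / pi * inverse (1 - (norm b)\<^sup>2) = K"
    using a by (auto simp: b_def K_def)
  have hol: "f holomorphic_on unit_disk" "f\<^sub>l holomorphic_on unit_disk"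
    using f fl by (auto simp: conformal_map_def)
  have nf: "norm (deriv f b) = K" and nfl: "norm (deriv f\<^sub>l b * l) = K"
    using norm_deriv_conformal_map_strip[OF f(1) _ b(1)] norm_deriv_conformal_map_strip[OF fl(1) _ b(1)]
      f(2) fl(2) K l by (simp_all add: norm_mult flip: b_def)
  have pos_real: "Re w = norm w" if "w \<in> \<real>" "Re w > 0" for w
    using that by (auto simp: complex_is_Real_iff cmod_eq_Re)
  have "partial_x u\<^sub>0 b = Re (deriv f b)"
    using differential_Re_holomorphic[OF hol(1) open_ball b(2)] by (simp add: u0 partial_x_def)
  then have px: "partial_x u\<^sub>0 b = K"
    using pos_real f_deriv nf by (simp flip: b_def)
  have "differential u\<^sub>l b l = Re (deriv f\<^sub>l b * l)"
    using differential_Re_holomorphic[OF hol(2) open_ball b(2)] by (simp add: ul)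
  then have dl: "differential u\<^sub>l b l = K"
    using pos_real fl_deriv nfl by (simp flip: b_def)
  have ul_comp: "u\<^sub>l \<in> harmonic_competitors"
    using Re_conformal_map_competitor fl ul by simp
  \<comment> \<open>The chain \<open>K \<le> L_dir \<le> L_grad \<le> K\<close>; its first link is the competitor \<open>Re f\<^sub>l\<close>.\<close>
  have dir_le: "L_dir b l \<le> L_grad b"
    unfolding L_dir_def L_grad_def
  proof (rule SUP_subset_mono[OF order_refl])
    fix u assume "u \<in> harmonic_competitors"
    then have "u differentiable (at b)"
      using b by (auto simp: harmonic_competitors_def harmonic_on_def C2_on_def C1_on_def)
    then show "ereal \<bar>differential u b l\<bar> \<le> ereal (norm (gradient u b))"
      using abs_differential_le_norm_gradient l by simp
  qed
  have grad_le: "L_grad b \<le> ereal K"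
    unfolding L_grad_def using competitor_norm_gradient_le[OF _ b(1)] K
    by (intro SUP_least) simp
  have "ereal K \<le> L_dir b l"
    unfolding L_dir_def
    by (rule SUP_upper2[OF ul_comp]) (simp add: dl)
  then have "L_grad b = ereal K" "L_dir b l = ereal K"
    using dir_le grad_le by (auto intro: antisym order_trans)
  then show ?thesis
    using px dl by (simp add: b_def K_def)
qed

end
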